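(* There exists a quadratic normalisation $(S,N)$ of class $(4,4)$ such that the associated rewriting system $(S,R)$, with $R=\{\,s|t\to\overline{N}(s|t): s,t\in S,\ s|t\ne\overline{N}(s|t)\,\}$, is not convergent.
   Context: For a set $S$, $S^*$ is the free monoid of words over $S$, $\|w\|$ is word length, $u|v$ is concatenation, $S^{[p]}$ is the set of words of length $p$. A normalisation is a pair $(S,N)$ with $N:S^*\to S^*$ such that for all words $u,v,w$: $\|N(w)\|=\|w\|$; $\|w\|=1$ implies $N(w)=w$; $N(u|N(w)|v)=N(u|w|v)$. A word is $N$-normal if $N(w)=w$. $\overline{N}$ is the restriction of $N$ to $S^{[2]}$; $\overline{N}_i$ applies $\overline{N}$ to the entries in positions $i,i+1$; $\overline{N}_{i_1\cdots i_n}=\overline{N}_{i_n}\circ\cdots\circ\overline{N}_{i_1}$. $(S,N)$ is quadratic if (a) a word is $N$-normal iff each of its length-two factors is, and (b) for every word $w$ there is a finite sequence $u$ of positions with $N(w)=\overline{N}_u(w)$. It is of class $(4,4)$ if $N(w)=\overline{N}_{1212}(w)=\overline{N}_{2121}(w)$ for all $w\in S^{[3]}$. For a rewriting system $(S,R)$, $\to_R$ is the relation $u|w|v\to_R u|w'|v$ for $u,v\in S^*$ and $w\to w'$ in $R$; $\to_R^*$ is its reflexive-transitive closure. It is confluent if $w\to_R^*w_1$, $w\to_R^*w_2$ imply $w_1\to_R^*w'$, $w_2\to_R^*w'$ for some $w'$; it terminates if there is no infinite sequence of $\to_R$-steps; convergent means confluent and terminating. *)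

theory Defs
  imports Main "HOL-Library.FuncSet" "HOL-Library.Sublist" "HOL-Library.Confluence"
begin

definition words_of_length :: "'a set \<Rightarrow> nat \<Rightarrow> 'a list set" where
  "words_of_length S p = {w \<in> lists S. length w = p}"

text \<open>
  The free monoid over \<open>S\<close> is \<^term>\<open>lists S\<close>. The values of \<open>N\<close> outside
  \<^term>\<open>lists S\<close> play no role.
\<close>

definition normalisation :: "'a set \<Rightarrow> ('a list \<Rightarrow> 'a list) \<Rightarrow> bool" where
  "normalisation S N \<longleftrightarrow>
     N \<in> lists S \<rightarrow> lists S \<and>
     (\<forall>w \<in> lists S. length (N w) = length w) \<and>
     (\<forall>w \<in> lists S. length w = 1 \<longrightarrow> N w = w) \<and>
     (\<forall>u \<in> lists S. \<forall>v \<in> lists S. \<forall>w \<in> lists S. N (u @ N w @ v) = N (u @ w @ v))"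

definition normal_word :: "('a list \<Rightarrow> 'a list) \<Rightarrow> 'a list \<Rightarrow> bool" where
  "normal_word N w \<longleftrightarrow> N w = w"

definition Nbar :: "'a set \<Rightarrow> ('a list \<Rightarrow> 'a list) \<Rightarrow> 'a list \<Rightarrow> 'a list" where
  "Nbar S N = restrict N (words_of_length S 2)"

text \<open>
  Positions count from 1, so \<open>Nbar_at S N i w\<close> is meaningful only for \<open>1 \<le> i < length w\<close>.
\<close>

definition Nbar_at :: "'a set \<Rightarrow> ('a list \<Rightarrow> 'a list) \<Rightarrow> nat \<Rightarrow> 'a list \<Rightarrow> 'a list" where
  "Nbar_at S N i w = take (i - 1) w @ Nbar S N (take 2 (drop (i - 1) w)) @ drop (i + 1) w"

text \<open>The leftmost position of the sequence is applied first.\<close>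

definition Nbar_seq :: "'a set \<Rightarrow> ('a list \<Rightarrow> 'a list) \<Rightarrow> nat list \<Rightarrow> 'a list \<Rightarrow> 'a list" where
  "Nbar_seq S N is w = fold (Nbar_at S N) is w"

definition quadratic_normalisation :: "'a set \<Rightarrow> ('a list \<Rightarrow> 'a list) \<Rightarrow> bool" where
  "quadratic_normalisation S N \<longleftrightarrow>
     normalisation S N \<and>
     (\<forall>w \<in> lists S. normal_word N w \<longleftrightarrow>
        (\<forall>f. sublist f w \<and> length f = 2 \<longrightarrow> normal_word N f)) \<and>
     (\<forall>w \<in> lists S. \<exists>is. set is \<subseteq> {1..<length w} \<and> N w = Nbar_seq S N is w)"

definition class_4_4 :: "'a set \<Rightarrow> ('a list \<Rightarrow> 'a list) \<Rightarrow> bool" where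
  "class_4_4 S N \<longleftrightarrow>
     (\<forall>w \<in> words_of_length S 3.
        N w = Nbar_seq S N [1, 2, 1, 2] w \<and> N w = Nbar_seq S N [2, 1, 2, 1] w)"

definition associated_rules ::
  "'a set \<Rightarrow> ('a list \<Rightarrow> 'a list) \<Rightarrow> ('a list \<times> 'a list) set" where
  "associated_rules S N =
     {([s, t], Nbar S N [s, t]) | s t. s \<in> S \<and> t \<in> S \<and> [s, t] \<noteq> Nbar S N [s, t]}"

inductive rewrite_step :: "'a set \<Rightarrow> ('a list \<times> 'a list) set \<Rightarrow> 'a list \<Rightarrow> 'a list \<Rightarrow> bool"
  for S R where
  "u \<in> lists S \<Longrightarrow> v \<in> lists S \<Longrightarrow> (w, w') \<in> R \<Longrightarrow> rewrite_step S R (u @ w @ v) (u @ w' @ v)"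

definition terminating :: "'a set \<Rightarrow> ('a list \<times> 'a list) set \<Rightarrow> bool" where
  "terminating S R \<longleftrightarrow> \<not> (\<exists>f :: nat \<Rightarrow> 'a list. \<forall>n. rewrite_step S R (f n) (f (Suc n)))"

text \<open>
  The library notion \<^const>\<open>confluentp\<close> ranges over all lists. When \<open>R\<close> consists of
  pairs of words over \<open>S\<close>, lists outside \<^term>\<open>lists S\<close> admit no step and hence
  satisfy the condition trivially.
\<close>

definition convergent_rewriting :: "'a set \<Rightarrow> ('a list \<times> 'a list) set \<Rightarrow> bool" where
  "convergent_rewriting S R \<longleftrightarrow> confluentp (rewrite_step S R) \<and> terminating S R"

end

theory Submission
  imports Defs
begin

text \<open>
  Consider the letters \<open>a, b, b', b'', c, c', c'', d\<close> and the rules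
  \<open>ab \<rightarrow> ab'\<close>, \<open>b'c' \<rightarrow> bc\<close>, \<open>bc' \<rightarrow> b''c''\<close>, \<open>b'c \<rightarrow> b''c''\<close>, \<open>cd \<rightarrow> c'd\<close>.
  They admit the cycle \<open>abc'd \<rightarrow> ab'c'd \<rightarrow> abcd \<rightarrow> abc'd\<close>. No rule changes whether a letter is
  \<open>a\<close>, one of the \<open>b\<close>s, one of the \<open>c\<close>s or \<open>d\<close>, so a rule application only affects a factor
  of the form \<open>(a)bc(d)\<close>, \<open>ab\<close> or \<open>cd\<close>, and these factors do not interact. Each of them has
  exactly one normal form; in particular \<open>abc'd\<close> escapes from the cycle to \<open>ab''c''d\<close>.
\<close>

section \<open>The normal form map and its compatibility with the rules\<close>

text \<open>
  The letters \<open>a, b, b', b'', c, c', c'', d\<close> are \<open>0, \<dots>, 7\<close>; all other numbers are inert.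
  The flags tell whether the two letters are preceded by \<open>a\<close> and followed by \<open>d\<close>.
\<close>

definition bc_normal_form :: "bool \<Rightarrow> bool \<Rightarrow> nat \<Rightarrow> nat \<Rightarrow> nat list" where
  "bc_normal_form p q x y =
     (if (x = 1 \<or> x = 2) \<and> (y = 4 \<or> y = 5) \<and> (p \<or> q) \<or> x = 1 \<and> y = 5 \<or> x = 2 \<and> y = 4
        then [3, 6]
      else if x = 2 \<and> y = 5 then [1, 4]
      else [if p \<and> x = 1 then 2 else x, if q \<and> y = 4 then 5 else y])"

text \<open>The flag \<open>p\<close> records a preceding \<open>a\<close>. A bc pair is consumed in
  one piece because its normal form depends on both neighbours. Testing the original neighbours
  suffices, since no rule changes the kind of a letter.\<close>

fun normal_form :: "bool \<Rightarrow> nat list \<Rightarrow> nat list" where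
  "normal_form p [] = []"
| "normal_form p [x] = [if p \<and> x = 1 then 2 else x]"
| "normal_form p (x # y # w) =
     (if x \<in> {1, 2, 3} \<and> y \<in> {4, 5, 6}
        then bc_normal_form p (w \<noteq> [] \<and> hd w = 7) x y @ normal_form False w
      else (if p \<and> x = 1 then 2 else if x = 4 \<and> y = 7 then 5 else x) #
             normal_form (x = 0) (y # w))"

abbreviation N :: "nat list \<Rightarrow> nat list" where
  "N \<equiv> normal_form False"

lemma length_bc_normal_form [simp]: "length (bc_normal_form p q x y) = 2"
  by (simp add: bc_normal_form_def)

lemma length_normal_form [simp]: "length (normal_form p w) = length w"
  by (induction p w rule: normal_form.induct) simp_all

lemma N_pair_eq_iff:
  "N [x, y] = [x, y] \<longleftrightarrow> (x, y) \<notin> {(0, 1), (2, 5), (1, 5), (2, 4), (4, 7)}"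
  by (auto simp: bc_normal_form_def)

text \<open>Only the five left-hand sides change. Behind two or more letters of prefix, the
  recursion sees the rest only through whether it starts with \<open>d\<close>, which no rule
  alters; shorter prefixes are evaluated.\<close>

lemma normal_form_append_pair:
  "normal_form p (u @ N [x, y] @ v) = normal_form p (u @ x # y # v)"
proof (cases "N [x, y] = [x, y]")
  case True
  then show ?thesis
    by (simp only: append_Cons append_Nil)
next
  case False
  then have xy: "(x, y) \<in> {(0, 1), (2, 5), (1, 5), (2, 4), (4, 7)}"
    using N_pair_eq_iff by blast
  show ?thesis
  proof (induction p u rule: normal_form.induct)
    case (1 p)
    from xy show ?case
      by (cases v; elim insertE emptyE Pair_inject; simp add: bc_normal_form_def)
  next
    case (2 p z)
    from xy show ?case
      by (cases v; elim insertE emptyE Pair_inject; simp add: bc_normal_form_def)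
  next
    case (3 p z z' u)
    have "(u @ N [x, y] @ v \<noteq> [] \<and> hd (u @ N [x, y] @ v) = 7) =
          (u @ x # y # v \<noteq> [] \<and> hd (u @ x # y # v) = 7)"
      using xy by (cases u) (auto simp: bc_normal_form_def)
    with 3 show ?case
      by simp
  qed
qed

lemma bc_normal_form_eq_iff:
  assumes "x \<in> {1, 2, 3}" "y \<in> {4, 5, 6}"
  shows "bc_normal_form p q x y = [x, y] \<longleftrightarrow>
    (p \<longrightarrow> x \<noteq> 1) \<and> (x, y) \<notin> {(2, 5), (1, 5), (2, 4)} \<and> (q \<longrightarrow> y \<noteq> 4)"
  using assms by (elim insertE emptyE; simp add: bc_normal_form_def)

text \<open>The flag becomes a literal leading \<open>0\<close>, so that the rule for
  \<open>ab\<close> acts on a pair like any other. With \<open>p\<close> false this gives the factor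
  condition for quadraticity.\<close>

lemma normal_form_eq_self_iff:
  "normal_form p w = w \<longleftrightarrow> successively (\<lambda>x y. N [x, y] = [x, y]) (if p then 0 # w else w)"
  unfolding N_pair_eq_iff
proof (induction p w rule: normal_form.induct)
  case (3 p x y w)
  let ?P = "\<lambda>x y. (x, y) \<notin> {(0, 1), (2, 5), (1, 5), (2, 4), (4, 7::nat)}"
  show ?case
  proof (cases "x \<in> {1, 2, 3} \<and> y \<in> {4, 5, 6}")
    case True
    let ?q = "w \<noteq> [] \<and> hd w = 7"
    have "normal_form p (x # y # w) = x # y # w \<longleftrightarrow>
        bc_normal_form p ?q x y @ N w = [x, y] @ w"
      using True by simp
    also have "\<dots> \<longleftrightarrow> bc_normal_form p ?q x y = [x, y] \<and> N w = w"
      by (rule append_eq_append_conv) simp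
    finally have "normal_form p (x # y # w) = x # y # w \<longleftrightarrow>
        bc_normal_form p ?q x y = [x, y] \<and> successively ?P w"
      using "3.IH"(1) True by simp
    also have "\<dots> \<longleftrightarrow> successively ?P (if p then 0 # x # y # w else x # y # w)"
      using True by (cases w; elim conjE insertE emptyE; simp add: bc_normal_form_eq_iff)
    finally show ?thesis .
  next
    case False
    then have "normal_form p (x # y # w) = x # y # w \<longleftrightarrow>
        \<not> (p \<and> x = 1) \<and> \<not> (x = 4 \<and> y = 7) \<and> normal_form (x = 0) (y # w) = y # w"
      unfolding normal_form.simps(3) if_not_P[OF False] by simp
    also have "normal_form (x = 0) (y # w) = y # w \<longleftrightarrow>
        successively ?P (if x = 0 then 0 # y # w else y # w)"
      using False by (rule "3.IH"(2))
    finally show ?thesis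
      using False by auto
  qed
qed simp_all

section \<open>Sequences of rule applications\<close>

lemma Nbar_at_append:
  assumes "i \<ge> 1" "i < length w"
  shows "Nbar_at S M (i + length u) (u @ w @ v) = u @ Nbar_at S M i w @ v"
  using assms by (cases "i") (auto simp: Nbar_at_def)

lemma Nbar_at_eq:
  assumes "i \<ge> 1" "i < length w"
  shows "\<exists>u x y v. w = u @ x # y # v \<and> length u = i - 1 \<and> Nbar_at UNIV M i w = u @ M [x, y] @ v"
proof -
  have "w = take (i - 1) w @ w ! (i - 1) # w ! i # drop (i + 1) w"
    using assms by (metis Cons_nth_drop_Suc Suc_diff_1 Suc_eq_plus1 append_take_drop_id
        less_imp_diff_less zero_less_one less_le_trans)
  then obtain u x y v where w: "w = u @ x # y # v" "length u = i - 1"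
    using assms by (metis length_take less_imp_diff_less min.absorb2 less_imp_le)
  then have "Nbar_at UNIV M i w = u @ M [x, y] @ v"
    using assms by (simp add: Nbar_at_def Nbar_def words_of_length_def)
  with w show ?thesis by blast
qed

text \<open>Turns the existence of positions in the second quadratic condition into a relation that
  composes and is stable under context.\<close>

definition reaches :: "nat list \<Rightarrow> nat list \<Rightarrow> bool" where
  "reaches w w' \<longleftrightarrow> (\<exists>ps. set ps \<subseteq> {1..<length w} \<and> w' = Nbar_seq UNIV N ps w)"

lemma length_Nbar_at:
  "i \<ge> 1 \<Longrightarrow> i < length w \<Longrightarrow> length (Nbar_at UNIV N i w) = length w"
  using Nbar_at_eq[of i w N] by auto

lemma length_Nbar_seq:
  "set ps \<subseteq> {1..<length w} \<Longrightarrow> length (Nbar_seq UNIV N ps w) = length w"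
  by (induction ps arbitrary: w) (auto simp: Nbar_seq_def length_Nbar_at)

lemma reaches_refl: "reaches w w"
  unfolding reaches_def by (rule exI[of _ "[]"]) (simp add: Nbar_seq_def)

lemma reaches_trans:
  assumes "reaches w w'" "reaches w' w''"
  shows "reaches w w''"
proof -
  obtain ps qs where "set ps \<subseteq> {1..<length w}" "w' = Nbar_seq UNIV N ps w"
    "set qs \<subseteq> {1..<length w'}" "w'' = Nbar_seq UNIV N qs w'"
    using assms unfolding reaches_def by blast
  then show ?thesis
    unfolding reaches_def
    by (intro exI[of _ "ps @ qs"]) (auto simp: Nbar_seq_def length_Nbar_seq[unfolded Nbar_seq_def])
qed

lemma reaches_append:
  assumes "reaches w w'"
  shows "reaches (u @ w @ v) (u @ w' @ v)"
proof -
  obtain ps where ps: "set ps \<subseteq> {1..<length w}" "w' = Nbar_seq UNIV N ps w"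
    using assms unfolding reaches_def by blast
  have "Nbar_seq UNIV N (map (\<lambda>i. i + length u) ps) (u @ w @ v) = u @ Nbar_seq UNIV N ps w @ v"
    using ps(1)
    by (induction ps arbitrary: w) (auto simp: Nbar_seq_def Nbar_at_append length_Nbar_at)
  with ps show ?thesis
    unfolding reaches_def by (intro exI[of _ "map (\<lambda>i. i + length u) ps"]) auto
qed

text \<open>Each position replaces one length-two factor, so \<open>normal_form_append_pair\<close>
  applies step by step. With \<open>reaches_N\<close> this yields
  \<open>N (u @ N w @ v) = N (u @ w @ v)\<close>.\<close>

lemma normal_form_append_reaches:
  assumes "reaches w w'"
  shows "normal_form p (u @ w' @ v) = normal_form p (u @ w @ v)"
proof -
  have at: "normal_form p (u @ Nbar_at UNIV N i w @ v) = normal_form p (u @ w @ v)"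
    if i: "i \<ge> 1" "i < length w" for i w
  proof -
    obtain u' x y v' where "w = u' @ x # y # v'" "Nbar_at UNIV N i w = u' @ N [x, y] @ v'"
      using Nbar_at_eq[OF i] by blast
    then show ?thesis
      using normal_form_append_pair[of p "u @ u'" x y "v' @ v"] by simp
  qed
  have "normal_form p (u @ Nbar_seq UNIV N ps w @ v) = normal_form p (u @ w @ v)"
    if "set ps \<subseteq> {1..<length w}" for ps
    using that by (induction ps arbitrary: w) (auto simp: Nbar_seq_def at length_Nbar_at)
  with assms show ?thesis
    unfolding reaches_def by blast
qed

lemma Nbar_at_simps:
  "Nbar_at UNIV M (Suc 0) (x # y # w) = M [x, y] @ w"
  "Nbar_at UNIV M 2 (x # y # z # w) = x # M [y, z] @ w"
  "Nbar_at UNIV M 3 (x # y # z # z' # w) = x # y # M [z, z'] @ w"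
  by (auto simp: Nbar_at_def Nbar_def words_of_length_def)

lemma reaches_bc:
  assumes "x \<in> {1, 2, 3}" "y \<in> {4, 5, 6}"
  shows "reaches [x, y] (bc_normal_form False False x y)"
    and "reaches [0, x, y] (0 # bc_normal_form True False x y)"
    and "reaches [x, y, 7] (bc_normal_form False True x y @ [7])"
    and "reaches [0, x, y, 7] (0 # bc_normal_form True True x y @ [7])"
proof -
  note simps = Nbar_seq_def Nbar_at_simps bc_normal_form_def
  show "reaches [x, y] (bc_normal_form False False x y)"
    unfolding reaches_def using assms
    by (intro exI[of _ "[1]"]) (auto simp: simps)
  show "reaches [0, x, y] (0 # bc_normal_form True False x y)"
    unfolding reaches_def using assms
    \<comment> \<open>Here \<open>abc'\<close> passes through \<open>ab'c'\<close>,
      \<open>abc\<close>, \<open>ab'c\<close> to \<open>ab''c''\<close>, using all four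
      positions.\<close>
    by (intro exI[of _ "[1, 2, 1, 2]"]) (auto simp: simps)
  show "reaches [x, y, 7] (bc_normal_form False True x y @ [7])"
    unfolding reaches_def using assms
    \<comment> \<open>Here \<open>b'c'd\<close> passes through \<open>bcd\<close> and
      \<open>bc'd\<close> to \<open>b''c''d\<close>.\<close>
    by (intro exI[of _ "[1, 2, 1]"]) (auto simp: simps)
  show "reaches [0, x, y, 7] (0 # bc_normal_form True True x y @ [7])"
    unfolding reaches_def using assms
    \<comment> \<open>Position 1 takes \<open>abcd\<close> out of the cycle to \<open>ab'cd\<close>,
      where position 3 would continue the cycle. The final 3 acts only on
      \<open>ab''cd\<close>.\<close>
    by (intro exI[of _ "[1, 2, 1, 2, 3]"]) (auto simp: simps)
qed

lemma reaches_Nbar: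
  "reaches [x, y] (N [x, y])"
  unfolding reaches_def by (intro exI[of _ "[1]"]) (simp add: Nbar_seq_def Nbar_at_simps)

text \<open>A leading \<open>d\<close> survives, so the tail can be normalised before a bc pair
  without losing its right context.\<close>

lemma hd_normal_form_7: "w \<noteq> [] \<Longrightarrow> hd w = 7 \<Longrightarrow> \<exists>v. w = 7 # v \<and> N w = 7 # N v"
  by (cases w; cases "tl w") auto

lemma reaches_normal_form:
  "reaches (if p then 0 # w else w) (if p then 0 # normal_form p w else normal_form p w)"
proof (induction p w rule: normal_form.induct)
  case (1 p)
  show ?case
    by (simp add: reaches_refl)
next
  case (2 p x)
  show ?case
    using reaches_refl reaches_Nbar[of 0 x] by auto
next
  case (3 p x y w)
  let ?b = "if p then [0] else []"
  show ?case
  proof (cases "x \<in> {1, 2, 3} \<and> y \<in> {4, 5, 6}")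
    case True
    with 3 have IH: "reaches w (N w)"
      by simp
    have xy: "reaches (?b @ x # y # N w) (?b @ bc_normal_form p (w \<noteq> [] \<and> hd w = 7) x y @ N w)"
    proof (cases "w \<noteq> [] \<and> hd w = 7")
      case seven: True
      then obtain v where "w = 7 # v" "N w = 7 # N v"
        using hd_normal_form_7 by blast
      then show ?thesis
        using True reaches_append[OF reaches_bc(3)[of x y], of "[]" "N v"]
          reaches_append[OF reaches_bc(4)[of x y], of "[]" "N v"] by auto
    next
      case False
      then show ?thesis
        using True reaches_append[OF reaches_bc(1)[of x y], of "[]" "N w"]
          reaches_append[OF reaches_bc(2)[of x y], of "[]" "N w"] by auto
    qed
    have "reaches (?b @ x # y # w) (?b @ x # y # N w)"
      using reaches_append[OF IH, of "?b @ [x, y]" "[]"] by simp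
    from reaches_trans[OF this xy] True show ?thesis
      by (auto split: if_splits)
  next
    case False
    then have IH: "reaches (if x = 0 then 0 # y # w else y # w)
      (if x = 0 then 0 # normal_form (x = 0) (y # w) else normal_form (x = 0) (y # w))"
      using 3 by simp
    define x' where "x' = (if p \<and> x = 1 then 2 else if x = 4 \<and> y = 7 then 5 else x)"
    have "reaches (?b @ x # y # w) (?b @ x' # y # w)"
      using reaches_refl reaches_append[OF reaches_Nbar[of 0 x], of "[]" "y # w"]
        reaches_append[OF reaches_Nbar[of x y], of ?b w]
      by (auto simp: x'_def bc_normal_form_def)
    \<comment> \<open>If \<open>x = 0\<close>, the induction hypothesis already contains
      \<open>x\<close> as its leading letter, so only \<open>?b\<close> is put in front.\<close>
    moreover have "reaches (?b @ x' # y # w) (?b @ x' # normal_form (x = 0) (y # w))"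
      using reaches_append[OF IH, of ?b "[]"] reaches_append[OF IH, of "?b @ [x']" "[]"]
      by (cases "x = 0") (simp_all add: x'_def)
    ultimately have "reaches (?b @ x # y # w) (?b @ x' # normal_form (x = 0) (y # w))"
      by (rule reaches_trans)
    moreover have "normal_form p (x # y # w) = x' # normal_form (x = 0) (y # w)"
      unfolding normal_form.simps(3) if_not_P[OF False] x'_def by simp
    ultimately show ?thesis
      by (cases p) (simp_all only: if_True if_False append.simps)
  qed
qed

lemma reaches_N: "reaches w (N w)"
  using reaches_normal_form[of False w] by simp

section \<open>The normalisation laws and quadraticity\<close>

lemma normalisation_N: "normalisation UNIV N"
proof -
  have "N w = w" if "length w = 1" for w
    using that by (cases w) auto
  then show ?thesis
    by (auto simp: normalisation_def normal_form_append_reaches[OF reaches_N])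
qed

lemma successively_iff_sublist:
  "successively P w \<longleftrightarrow> (\<forall>x y. sublist [x, y] w \<longrightarrow> P x y)"
proof (induction w rule: induct_list012)
  case (3 x y w)
  have "sublist [a, b] (x # y # w) \<longleftrightarrow> a = x \<and> b = y \<or> sublist [a, b] (y # w)" for a b
    by (simp add: sublist_Cons_right[of "[a, b]" x])
  with 3 show ?case
    by (simp only: successively.simps) blast
qed (simp_all add: sublist_Cons_right)

lemma successively_iff_factors:
  "successively (\<lambda>x y. P [x, y]) w \<longleftrightarrow> (\<forall>f. sublist f w \<and> length f = 2 \<longrightarrow> P f)"
proof -
  have length_2: "length f = 2 \<longleftrightarrow> (\<exists>x y. f = [x, y])" for f :: "'a list"
    by (auto simp: length_Suc_conv numeral_2_eq_2)
  show ?thesis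
    unfolding successively_iff_sublist length_2 by blast
qed

lemma quadratic_normalisation_N: "quadratic_normalisation UNIV N"
proof -
  have "normal_word N w \<longleftrightarrow> (\<forall>f. sublist f w \<and> length f = 2 \<longrightarrow> normal_word N f)" for w
    using normal_form_eq_self_iff[of False w] successively_iff_factors[of "\<lambda>f. N f = f" w]
    unfolding normal_word_def if_False by (rule trans)
  then show ?thesis
    using normalisation_N reaches_N unfolding quadratic_normalisation_def reaches_def by blast
qed

section \<open>Class (4,4) on words of length three\<close>

text \<open>Among three letters a bc pair cannot have both \<open>a\<close> and \<open>d\<close> as
  neighbours, so the cycle is out of reach and both position sequences end in the normal
  form.\<close>

lemma class_4_4_N: "class_4_4 UNIV N"
proof -
  have eq: "N [x, y, z] = Nbar_seq UNIV N [1, 2, 1, 2] [x, y, z] \<and>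
        N [x, y, z] = Nbar_seq UNIV N [2, 1, 2, 1] [x, y, z]" for x y z
  proof -
    \<comment> \<open>Letters above 7 are inert and behave alike, so nine cases per letter cover all
      triples.\<close>
    have letter: "n \<in> {0, 1, 2, 3, 4, 5, 6, 7} \<or> n > 7" for n :: nat
      by auto
    show ?thesis
      using letter[of x] letter[of y] letter[of z]
      unfolding insert_iff empty_iff
      by (elim disjE; simp add: Nbar_seq_def Nbar_at_simps bc_normal_form_def)
  qed
  show ?thesis
    unfolding class_4_4_def
  proof
    fix w :: "nat list"
    assume "w \<in> words_of_length UNIV 3"
    then obtain x y z where "w = [x, y, z]"
      by (auto simp: words_of_length_def length_Suc_conv numeral_3_eq_3)
    show "N w = Nbar_seq UNIV N [1, 2, 1, 2] w \<and> N w = Nbar_seq UNIV N [2, 1, 2, 1] w"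
      unfolding \<open>w = [x, y, z]\<close> by (rule eq)
  qed
qed

section \<open>An infinite rewriting sequence\<close>

lemma rewrite_stepI:
  assumes "N [x, y] = [x', y']" "[x', y'] \<noteq> [x, y]"
  shows "rewrite_step UNIV (associated_rules UNIV N) (u @ [x, y] @ v) (u @ [x', y'] @ v)"
  using assms
  by (intro rewrite_step.intros)
    (auto simp: associated_rules_def Nbar_def words_of_length_def simp del: normal_form.simps)

lemma not_terminating_N: "\<not> terminating UNIV (associated_rules UNIV N)"
proof -
  let ?step = "rewrite_step UNIV (associated_rules UNIV N)"
  \<comment> \<open>The words \<open>abc'd\<close>, \<open>ab'c'd\<close>, \<open>abcd\<close> recur
    with period three; each round rewrites at positions 1, 2, 3 in turn.\<close>
  define f :: "nat \<Rightarrow> nat list" where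
    "f n = (if n mod 3 = 0 then [0, 1, 5, 7] else if n mod 3 = 1 then [0, 2, 5, 7] else [0, 1, 4, 7])"
    for n
  have "?step [0, 1, 5, 7] [0, 2, 5, 7]"
    using rewrite_stepI[of 0 1 0 2 "[]" "[5, 7]"] by simp
  moreover have "?step [0, 2, 5, 7] [0, 1, 4, 7]"
    using rewrite_stepI[of 2 5 1 4 "[0]" "[7]"] by (simp add: bc_normal_form_def)
  moreover have "?step [0, 1, 4, 7] [0, 1, 5, 7]"
    using rewrite_stepI[of 4 7 5 7 "[0, 1]" "[]"] by simp
  ultimately have "?step (f n) (f (Suc n))" for n
    by (auto simp: f_def mod_Suc)
  then show ?thesis
    unfolding terminating_def by blast
qed

theorem proposition5p3p1:
  shows "\<exists>(S :: nat set) N.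
    quadratic_normalisation S N \<and> class_4_4 S N \<and>
    \<not> convergent_rewriting S (associated_rules S N)"
  using quadratic_normalisation_N class_4_4_N not_terminating_N
  unfolding convergent_rewriting_def by blast

end
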